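(* Suppose that $A\in\mathbb{R}^{n\times n}$ is an EP-matrix. Then: 1) $cA$ is an EP-matrix for any $c\in\mathbb{R}$. 2) $A^T$ is an EP-matrix. 3) If $Q\in\mathbb{R}^{n\times n}$ is a permutation matrix then $QAQ^T$ is an EP-matrix. 4) If $D\in\mathbb{R}^{n\times n}$ is a positive diagonal matrix then $DAD^{-1}$ is an EP-matrix. 5) If $S\in\mathbb{R}^{n\times n}$ is a signature matrix then $SAS$ is an EP-matrix. 6) If $D\in\mathbb{R}^{n\times n}$ is a diagonal matrix and $DA=AD$ then $A+D$ is an EP-matrix.
   Context: A matrix in $\mathbb{R}^{n\times n}$ is called a P-matrix if all its principal minors are positive. A matrix $A\in\mathbb{R}^{n\times n}$ is called an EP-matrix (exponential P-matrix) if $\exp(At)$ is a P-matrix for all $t\ge 0$. A permutation matrix has exactly one entry equal to $1$ in each row and each column and zeros elsewhere. A positive diagonal matrix is a diagonal matrix whose diagonal entries are all positive. A signature matrix is a diagonal matrix in which every diagonal entry is $1$ or $-1$. *)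

theory Defs
  imports "HOL-Analysis.Analysis"
begin

text \<open>Multiplication and powers of the vector type are componentwise, and it is not an
  instance of the classes needed by \<^const>\<open>exp\<close>; hence matrix powers and the matrix
  exponential are introduced here, with respect to \<^const>\<open>matrix_matrix_mult\<close>.\<close>

primrec matrix_power :: "real^'n^'n \<Rightarrow> nat \<Rightarrow> real^'n^'n" where
  "matrix_power A 0 = mat 1"
| "matrix_power A (Suc k) = A ** matrix_power A k"

definition matrix_exp :: "real^'n^'n \<Rightarrow> real^'n^'n" where
  "matrix_exp A = (\<Sum>k. (1 / fact k) *\<^sub>R matrix_power A k)"

lemma summable_matrix_exp:
  fixes A :: "real^'n^'n"
  shows "summable (\<lambda>k. (1 / fact k) *\<^sub>R matrix_power A k)"
proof -
  have "bilinear ((**) :: real^'n^'n \<Rightarrow> real^'n^'n \<Rightarrow> real^'n^'n)"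
    unfolding bilinear_def
  proof (intro conjI allI)
    fix M :: "real^'n^'n"
    show "linear (\<lambda>N. M ** N)"
      by (rule linearI) (simp_all add: vec_eq_iff matrix_matrix_mult_def distrib_left
          sum.distrib sum_distrib_left mult.left_commute)
    show "linear (\<lambda>N. N ** M)"
      by (rule linearI) (simp_all add: vec_eq_iff matrix_matrix_mult_def distrib_right
          sum.distrib sum_distrib_left mult.assoc)
  qed
  then have "bounded_bilinear ((**) :: real^'n^'n \<Rightarrow> real^'n^'n \<Rightarrow> real^'n^'n)"
    by (simp add: bilinear_conv_bounded_bilinear)
  from bounded_bilinear.nonneg_bounded[OF this]
  obtain K where K: "0 \<le> K" "\<And>(M :: real^'n^'n) (N :: real^'n^'n). norm (M ** N) \<le> norm M * norm N * K"
    by auto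
  have pow: "norm (matrix_power A k) \<le> (norm A * K) ^ k * norm (mat 1 :: real^'n^'n)" for k
  proof (induction k)
    case (Suc k)
    have "norm (matrix_power A (Suc k)) \<le> (norm A * K) * norm (matrix_power A k)"
      using K(2)[of A "matrix_power A k"] by (simp add: mult_ac)
    also have "\<dots> \<le> (norm A * K) * ((norm A * K) ^ k * norm (mat 1 :: real^'n^'n))"
      using K(1) Suc.IH by (intro mult_left_mono) auto
    finally show ?case by (simp add: mult_ac)
  qed simp
  have "summable (\<lambda>k. inverse (fact k) * (norm A * K) ^ k * norm (mat 1 :: real^'n^'n))"
    by (intro summable_mult2 summable_exp)
  then show ?thesis
  proof (rule summable_comparison_test'[where N = 0])
    fix k :: nat
    have "inverse (fact k) * norm (matrix_power A k)
            \<le> inverse (fact k) * ((norm A * K) ^ k * norm (mat 1 :: real^'n^'n))"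
      by (intro mult_left_mono pow) simp
    then show "norm ((1 / fact k) *\<^sub>R matrix_power A k)
            \<le> inverse (fact k) * (norm A * K) ^ k * norm (mat 1 :: real^'n^'n)"
      by (simp add: divide_inverse mult_ac)
  qed
qed

text \<open>The determinant of the submatrix of \<open>A\<close> with rows and columns in \<open>S\<close>, given by the same
  formula as \<^const>\<open>det\<close> but over the index set \<open>S\<close>, because a submatrix of varying size
  is not of a fixed matrix type. The lemma \<open>principal_minor_range\<close> identifies it with
  \<^const>\<open>det\<close> of that submatrix under any enumeration of \<open>S\<close> by a finite type.\<close>

definition principal_minor :: "'a::comm_ring_1^'n^'n \<Rightarrow> 'n set \<Rightarrow> 'a" where
  "principal_minor A S = (\<Sum>p | p permutes S. of_int (sign p) * (\<Prod>i\<in>S. A $ i $ p i))"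

lemma principal_minor_UNIV: "principal_minor A UNIV = det A"
  by (simp add: principal_minor_def det_def)

lemma principal_minor_range:
  fixes A :: "'a::comm_ring_1^'n^'n" and f :: "'k::finite \<Rightarrow> 'n"
  assumes "inj f"
  shows "principal_minor A (range f) = det (\<chi> i j. A $ f i $ f j)"
proof -
  have bij: "bij_betw f UNIV (range f)" "bij_betw (inv f) (range f) UNIV"
    using assms inj_imp_bij_betw_inv[OF assms] by (simp_all add: bij_betw_def)
  have "det (\<chi> i j. A $ f i $ f j) =
      (\<Sum>p | p permutes (UNIV :: 'k set). of_int (sign p) * (\<Prod>i\<in>UNIV. A $ f i $ f (p i)))"
    by (simp add: det_def)
  also have "\<dots> = principal_minor A (range f)"
    unfolding principal_minor_def
  proof (rule sum.reindex_bij_witness[where i = "map_permutation (range f) (inv f)"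
        and j = "map_permutation UNIV f"], goal_cases)
    case (1 p)
    show ?case
      by (rule map_permutation_compose_inv[OF bij(1)]) (use 1 assms in simp_all)
  next
    case (2 p)
    then show ?case using map_permutation_permutes[OF bij(1)] by simp
  next
    case (3 q)
    show ?case
      by (rule map_permutation_compose_inv[OF bij(2)]) (use 3 in \<open>simp_all add: f_inv_into_f\<close>)
  next
    case (4 q)
    then show ?case using map_permutation_permutes[OF bij(2)] by simp
  next
    case (5 p)
    then have "sign (map_permutation UNIV f p) = sign p"
      by (intro sign_map_permutation) (use assms in auto)
    moreover have "(\<Prod>i\<in>range f. A $ i $ map_permutation UNIV f p i)
        = (\<Prod>i\<in>UNIV. A $ f i $ f (p i))"
      using assms by (simp add: prod.reindex map_permutation_apply)
    ultimately show ?case by simp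
  qed
  finally show ?thesis by simp
qed

definition P_matrix :: "real^'n^'n \<Rightarrow> bool" where
  "P_matrix A \<longleftrightarrow> (\<forall>S. S \<noteq> {} \<longrightarrow> principal_minor A S > 0)"

definition EP_matrix :: "real^'n^'n \<Rightarrow> bool" where
  "EP_matrix A \<longleftrightarrow> (\<forall>t::real. t \<ge> 0 \<longrightarrow> P_matrix (matrix_exp (t *\<^sub>R A)))"

definition permutation_matrix :: "real^'n^'n \<Rightarrow> bool" where
  "permutation_matrix Q \<longleftrightarrow>
     (\<forall>i j. Q $ i $ j = 0 \<or> Q $ i $ j = 1) \<and>
     (\<forall>i. \<exists>!j. Q $ i $ j = 1) \<and> (\<forall>j. \<exists>!i. Q $ i $ j = 1)"

definition diagonal_matrix :: "real^'n^'n \<Rightarrow> bool" where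
  "diagonal_matrix D \<longleftrightarrow> (\<forall>i j. i \<noteq> j \<longrightarrow> D $ i $ j = 0)"

definition positive_diagonal_matrix :: "real^'n^'n \<Rightarrow> bool" where
  "positive_diagonal_matrix D \<longleftrightarrow> diagonal_matrix D \<and> (\<forall>i. D $ i $ i > 0)"

definition signature_matrix :: "real^'n^'n \<Rightarrow> bool" where
  "signature_matrix S \<longleftrightarrow> diagonal_matrix S \<and> (\<forall>i. S $ i $ i = 1 \<or> S $ i $ i = -1)"

end

theory Submission
  imports Defs
begin

text \<open>Everything except negative scalars reduces to how \<^const>\<open>matrix_exp\<close> and principal minors
  behave under similarity, transposition and multiplication by diagonal matrices. For negative
  scalars, \<open>exp (-tA)\<close> is the inverse of \<open>exp (tA)\<close>, and the inverse of a P-matrix is a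
  P-matrix by Jacobi's identity: the minor of \<open>B\<inverse>\<close> at \<open>S\<close>, times \<open>det B\<close>, is the minor of
  \<open>B\<close> at the complement of \<open>S\<close>.\<close>

section \<open>The matrix exponential\<close>

lemma bounded_bilinear_matrix_matrix_mult:
  "bounded_bilinear ((**) :: real^'n^'n \<Rightarrow> real^'n^'n \<Rightarrow> real^'n^'n)"
proof -
  have "linear (\<lambda>N. M ** N)" "linear (\<lambda>N. N ** M)" for M :: "real^'n^'n"
    by (rule linearI; simp add: vec_eq_iff matrix_matrix_mult_def algebra_simps
        sum.distrib sum_distrib_left)+
  then show ?thesis
    unfolding bilinear_conv_bounded_bilinear[symmetric] bilinear_def by blast
qed

lemmas matrix_mult_scaleR_left = bounded_bilinear.scaleR_left[OF bounded_bilinear_matrix_matrix_mult]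
  and matrix_mult_scaleR_right = bounded_bilinear.scaleR_right[OF bounded_bilinear_matrix_matrix_mult]
  and matrix_mult_add_left = bounded_bilinear.add_left[OF bounded_bilinear_matrix_matrix_mult]
  and matrix_mult_add_right = bounded_bilinear.add_right[OF bounded_bilinear_matrix_matrix_mult]
  and matrix_mult_sum_left = bounded_bilinear.sum_left[OF bounded_bilinear_matrix_matrix_mult]
  and matrix_mult_sum_right = bounded_bilinear.sum_right[OF bounded_bilinear_matrix_matrix_mult]

lemma matrix_exp_sums: "(\<lambda>k. (1 / fact k) *\<^sub>R matrix_power A k) sums matrix_exp A"
  unfolding matrix_exp_def by (rule summable_sums[OF summable_matrix_exp])

lemma matrix_exp_sums_nth:
  "(\<lambda>k. (1 / fact k) * matrix_power A k $ i $ j) sums (matrix_exp A $ i $ j)"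
  using sums_vec_nth[OF sums_vec_nth[OF matrix_exp_sums, of A i], of j] by simp

lemma matrix_exp_eqI:
  assumes "(\<lambda>k. (1 / fact k) *\<^sub>R matrix_power A k) sums B"
  shows "matrix_exp A = B"
  using assms matrix_exp_sums sums_unique2 by blast

lemma matrix_power_scaleR: "matrix_power (t *\<^sub>R A) k = t ^ k *\<^sub>R matrix_power A k"
  by (induction k) (simp_all add: matrix_mult_scaleR_left matrix_mult_scaleR_right mult.commute)

lemma matrix_exp_zero: "matrix_exp (0 :: real^'n^'n) = mat 1"
proof (rule matrix_exp_eqI)
  have "matrix_power (0 :: real^'n^'n) k = (if k = 0 then mat 1 else 0)" for k
    by (cases k) (simp_all add: vec_eq_iff matrix_matrix_mult_def)
  then have *: "(\<lambda>k. (1 / fact k) *\<^sub>R matrix_power (0 :: real^'n^'n) k)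
      = (\<lambda>k. if k = 0 then mat 1 else 0)"
    by (simp add: fun_eq_iff)
  show "(\<lambda>k. (1 / fact k) *\<^sub>R matrix_power (0 :: real^'n^'n) k) sums mat 1"
    unfolding * using sums_single[of 0 "\<lambda>_. mat 1 :: real^'n^'n"] by simp
qed

text \<open>Convergence at \<open>2A\<close> gives absolute convergence at \<open>A\<close>, as for scalar power series.\<close>

lemma summable_abs_matrix_exp_nth:
  "summable (\<lambda>k. norm ((1 / fact k) * matrix_power A k $ i $ j))"
proof -
  have "summable (\<lambda>k. ((1 / fact k) * matrix_power A k $ i $ j) * 2 ^ k)"
    using sums_summable[OF matrix_exp_sums_nth[of "2 *\<^sub>R A" i j]]
    by (simp add: matrix_power_scaleR mult_ac)
  from powser_insidea[OF this, of 1] show ?thesis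
    by simp
qed

lemma matrix_power_commute:
  assumes "A ** B = B ** A"
  shows "matrix_power A k ** B = B ** matrix_power A k"
  by (induction k) (simp_all, metis assms matrix_mul_assoc)

text \<open>The binomial theorem for commuting matrices, divided by \<open>n!\<close>: in this form
  the right-hand side is the \<open>n\<close>-th term of a Cauchy product. The recurrence
  \<open>times_E\<close>, that is \<open>X ** E X k = (k+1) E X (k+1)\<close>, replaces Pascal's
  rule.\<close>

lemma matrix_power_add_div_fact:
  fixes A B :: "real^'n^'n"
  defines "E \<equiv> \<lambda>(X :: real^'n^'n) k. (1 / fact k) *\<^sub>R matrix_power X k"
  assumes comm: "A ** B = B ** A"
  shows "E (A + B) n = (\<Sum>i\<le>n. E A i ** E B (n - i))"
proof (induction n)
  case 0
  show ?case by (simp add: E_def)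
next
  case (Suc n)
  have times_E: "X ** E X k = real (Suc k) *\<^sub>R E X (Suc k)" for X k
    unfolding E_def by (simp add: matrix_mult_scaleR_right del: of_nat_Suc)
  have E_comm: "B ** E A k = E A k ** B" for k
    unfolding E_def
    by (simp add: matrix_mult_scaleR_left matrix_mult_scaleR_right matrix_power_commute[OF comm])
  have "real (Suc n) *\<^sub>R E (A + B) (Suc n) = (A + B) ** (\<Sum>i\<le>n. E A i ** E B (n - i))"
    by (simp only: times_E[symmetric] Suc.IH)
  also have "\<dots> = (\<Sum>i\<le>n. (A ** E A i) ** E B (n - i)) + (\<Sum>i\<le>n. (E A i ** B) ** E B (n - i))"
    by (simp add: matrix_mult_add_left matrix_mult_sum_right matrix_mul_assoc E_comm
        sum.distrib)
  also have "\<dots> = (\<Sum>i\<le>n. (A ** E A i) ** E B (n - i)) + (\<Sum>i\<le>n. E A i ** (B ** E B (n - i)))"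
    by (simp add: matrix_mul_assoc)
  also have "(\<Sum>i\<le>n. (A ** E A i) ** E B (n - i))
      = (\<Sum>i\<le>n. real (Suc i) *\<^sub>R (E A (Suc i) ** E B (n - i)))"
    by (simp only: times_E matrix_mult_scaleR_left)
  \<comment> \<open>After the shift the new term \<open>i = 0\<close> has coefficient 0. In the
    other sum the added term \<open>i = Suc n\<close> vanishes likewise, so both range over the same
    indices and their coefficients add up to \<open>Suc n\<close>.\<close>
  also have "\<dots> = (\<Sum>i\<le>Suc n. real i *\<^sub>R (E A i ** E B (Suc n - i)))"
    by (subst sum.atMost_Suc_shift) simp
  also have "(\<Sum>i\<le>n. E A i ** (B ** E B (n - i)))
      = (\<Sum>i\<le>Suc n. real (Suc n - i) *\<^sub>R (E A i ** E B (Suc n - i)))"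
    by (simp add: times_E matrix_mult_scaleR_right Suc_diff_le del: of_nat_Suc of_nat_diff)
  also have "(\<Sum>i\<le>Suc n. real i *\<^sub>R (E A i ** E B (Suc n - i)))
      + (\<Sum>i\<le>Suc n. real (Suc n - i) *\<^sub>R (E A i ** E B (Suc n - i)))
      = (\<Sum>i\<le>Suc n. real (Suc n) *\<^sub>R (E A i ** E B (Suc n - i)))"
    unfolding sum.distrib[symmetric] scaleR_left_distrib[symmetric] of_nat_add[symmetric]
    by (rule sum.cong) simp_all
  finally show ?case
    by (simp only: scaleR_right.sum[symmetric] scaleR_cancel_left of_nat_eq_0_iff) simp
qed

text \<open>The Cauchy product is formed entrywise: for each \<open>m\<close>, the real series for
  entries \<open>(i, m)\<close> of \<open>matrix_exp A\<close> and \<open>(m, j)\<close> of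
  \<open>matrix_exp B\<close> converge absolutely, and the finite sum over \<open>m\<close> is
  exchanged with the convolution.\<close>

lemma matrix_exp_add:
  fixes A B :: "real^'n^'n"
  assumes comm: "A ** B = B ** A"
  shows "matrix_exp (A + B) = matrix_exp A ** matrix_exp B"
proof -
  define e where "e X k i j = (1 / fact k) * matrix_power X k $ i $ j"
    for X :: "real^'n^'n" and k i j
  have exp_eq: "(\<Sum>k. e X k i j) = matrix_exp X $ i $ j" for X i j
    unfolding e_def by (rule sums_unique[OF matrix_exp_sums_nth, symmetric])
  have "matrix_exp (A + B) $ i $ j = (matrix_exp A ** matrix_exp B) $ i $ j" for i j
  proof (rule sums_unique2)
    show "(\<lambda>k. e (A + B) k i j) sums (matrix_exp (A + B) $ i $ j)"
      unfolding e_def by (rule matrix_exp_sums_nth)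
    have "(\<lambda>k. \<Sum>l\<le>k. e A l i m * e B (k - l) m j)
        sums (matrix_exp A $ i $ m * matrix_exp B $ m $ j)" for m
      using Cauchy_product_sums[of "\<lambda>k. e A k i m" "\<lambda>k. e B k m j"]
        summable_abs_matrix_exp_nth[of A i m] summable_abs_matrix_exp_nth[of B m j]
      unfolding exp_eq by (simp add: e_def)
    then have "(\<lambda>k. \<Sum>m\<in>UNIV. \<Sum>l\<le>k. e A l i m * e B (k - l) m j)
        sums (\<Sum>m\<in>UNIV. matrix_exp A $ i $ m * matrix_exp B $ m $ j)"
      by (rule sums_sum)
    moreover have "e (A + B) k i j = (\<Sum>m\<in>UNIV. \<Sum>l\<le>k. e A l i m * e B (k - l) m j)" for k
    proof -
      have "e (A + B) k i j = ((1 / fact k) *\<^sub>R matrix_power (A + B) k) $ i $ j"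
        by (simp add: e_def)
      also have "\<dots> = (\<Sum>l\<le>k. \<Sum>m\<in>UNIV. e A l i m * e B (k - l) m j)"
        unfolding matrix_power_add_div_fact[OF comm]
        by (simp only: sum_component matrix_matrix_mult_def e_def) simp
      finally show ?thesis by (simp only: sum.swap[of _ "{..k}"])
    qed
    ultimately show "(\<lambda>k. e (A + B) k i j) sums ((matrix_exp A ** matrix_exp B) $ i $ j)"
      by (simp add: matrix_matrix_mult_def)
  qed
  then show ?thesis by (simp add: vec_eq_iff)
qed

lemma matrix_exp_minus: "matrix_exp A ** matrix_exp (- A) = mat 1"
proof -
  have "A ** - A = - A ** A"
    by (simp add: vec_eq_iff matrix_matrix_mult_def)
  from matrix_exp_add[OF this] show ?thesis by (simp add: matrix_exp_zero)
qed

text \<open>The inner factors \<open>R ** P\<close> cancel in every power, and conjugation is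
  bounded linear, so it passes through the series.\<close>

lemma matrix_exp_similar:
  fixes A P R :: "real^'n^'n"
  assumes inv: "R ** P = mat 1"
  shows "matrix_exp (P ** A ** R) = P ** matrix_exp A ** R"
proof (rule matrix_exp_eqI)
  have inv': "P ** R = mat 1"
    using inv matrix_left_right_inverse by blast
  have "matrix_power (P ** A ** R) k = P ** matrix_power A k ** R" for k
  proof (induction k)
    case (Suc k)
    have "P ** A ** R ** (P ** matrix_power A k ** R)
        = P ** A ** (R ** P) ** matrix_power A k ** R"
      by (simp only: matrix_mul_assoc)
    then show ?case using Suc by (simp add: inv matrix_mul_assoc)
  qed (simp add: inv')
  moreover have "bounded_linear (\<lambda>M. P ** M ** R)"
    using bounded_linear_compose[OF
        bounded_bilinear.bounded_linear_left[OF bounded_bilinear_matrix_matrix_mult]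
        bounded_bilinear.bounded_linear_right[OF bounded_bilinear_matrix_matrix_mult]] .
  from bounded_linear.sums[OF this matrix_exp_sums]
  have "(\<lambda>k. P ** ((1 / fact k) *\<^sub>R matrix_power A k) ** R) sums (P ** matrix_exp A ** R)" .
  ultimately show "(\<lambda>k. (1 / fact k) *\<^sub>R matrix_power (P ** A ** R) k) sums (P ** matrix_exp A ** R)"
    by (simp add: matrix_mult_scaleR_left matrix_mult_scaleR_right)
qed

text \<open>Transposition reverses products, but a matrix commutes with its own powers, so the
  powers, and with them the series, can be transposed entry by entry.\<close>

lemma matrix_exp_transpose: "matrix_exp (transpose A) = transpose (matrix_exp A)"
proof -
  have pow: "matrix_power (transpose A) k = transpose (matrix_power A k)" for k
    by (induction k) (simp_all add: matrix_transpose_mul[symmetric] matrix_power_commute)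
  have "matrix_exp (transpose A) $ i $ j = transpose (matrix_exp A) $ i $ j" for i j
  proof (rule sums_unique2[OF matrix_exp_sums_nth])
    show "(\<lambda>k. (1 / fact k) * matrix_power (transpose A) k $ i $ j)
        sums (transpose (matrix_exp A) $ i $ j)"
      unfolding pow unfolding transpose_def vec_lambda_beta by (rule matrix_exp_sums_nth)
  qed
  then show ?thesis by (simp add: vec_eq_iff)
qed

section \<open>Diagonal matrices as row and column scalings\<close>

lemma diagonal_matrix_mult_left:
  assumes "diagonal_matrix D"
  shows "(D ** M) $ i $ j = D $ i $ i * M $ i $ j"
proof -
  have "(D ** M) $ i $ j = (\<Sum>k\<in>UNIV. if k = i then D $ i $ i * M $ i $ j else 0)"
    unfolding matrix_matrix_mult_def vec_lambda_beta using assms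
    by (intro sum.cong) (auto simp: diagonal_matrix_def)
  then show ?thesis by simp
qed

lemma diagonal_matrix_mult_right:
  assumes "diagonal_matrix D"
  shows "(M ** D) $ i $ j = M $ i $ j * D $ j $ j"
proof -
  have "(M ** D) $ i $ j = (\<Sum>k\<in>UNIV. if k = j then M $ i $ j * D $ j $ j else 0)"
    unfolding matrix_matrix_mult_def vec_lambda_beta using assms
    by (intro sum.cong) (auto simp: diagonal_matrix_def)
  then show ?thesis by simp
qed

lemma matrix_exp_diagonal:
  assumes "diagonal_matrix D"
  shows "matrix_exp D = (\<chi> i j. if i = j then exp (D $ i $ i) else 0)"
proof -
  have pow: "matrix_power D k $ i $ j = (if i = j then (D $ i $ i) ^ k else 0)" for k i j
    by (induction k arbitrary: i j) (auto simp: mat_def diagonal_matrix_mult_left[OF assms])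
  have "matrix_exp D $ i $ j = (if i = j then exp (D $ i $ i) else 0)" for i j
  proof (cases "i = j")
    case True
    then show ?thesis
      using matrix_exp_sums_nth[of D i j] exp_converges[of "D $ i $ i"]
      by (simp add: pow divide_inverse_commute sums_unique2 scaleR_conv_of_real)
  next
    case False
    then show ?thesis
      using matrix_exp_sums_nth[of D i j] by (simp add: pow sums_unique2[OF _ sums_zero])
  qed
  then show ?thesis by (simp add: vec_eq_iff)
qed

section \<open>Principal minors\<close>

text \<open>Turns a principal minor into a determinant of full size, to which multiplicativity and
  invariance under transposition apply. Only the columns outside \<open>S\<close> are prescribed;
  entries in rows outside \<open>S\<close> and columns inside \<open>S\<close> are arbitrary, a
  freedom that Jacobi's identity uses.\<close>

lemma det_eq_principal_minor:
  assumes "\<And>i j. i \<in> S \<Longrightarrow> j \<in> S \<Longrightarrow> N $ i $ j = M $ i $ j"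
    and "\<And>i j. j \<notin> S \<Longrightarrow> N $ i $ j = (if i = j then 1 else 0)"
  shows "det N = principal_minor M S"
proof -
  have "det N = (\<Sum>p | p permutes S. of_int (sign p) * (\<Prod>i\<in>UNIV. N $ i $ p i))"
    unfolding det_def
  proof (rule sum.mono_neutral_right)
    show "{p. p permutes S} \<subseteq> {p. p permutes UNIV}"
      using permutes_subset by blast
    show "\<forall>p\<in>{p. p permutes UNIV} - {p. p permutes S}.
        of_int (sign p) * (\<Prod>i\<in>UNIV. N $ i $ p i) = 0"
    proof
      fix p assume "p \<in> {p. p permutes UNIV} - {p. p permutes S}"
      then have p: "bij p" and "\<not> p permutes S"
        by (auto simp: permutes_bij)
      then obtain j where j: "j \<notin> S" "p j \<noteq> j"
        unfolding permutes_def bij_iff by blast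
      \<comment> \<open>Since \<open>p\<close> moves \<open>j\<close>, the row \<open>i\<close> that
        \<open>p\<close> sends to \<open>j\<close> differs from \<open>j\<close>; the factor it
        contributes is thus an off-diagonal entry of a unit column.\<close>
      obtain i where "p i = j"
        using bij_is_surj[OF p] by (metis surjD)
      with j have "N $ i $ p i = 0"
        using assms(2) by auto
      then have "(\<Prod>i\<in>UNIV. N $ i $ p i) = 0"
        by (intro prod_zero) auto
      then show "of_int (sign p) * (\<Prod>i\<in>UNIV. N $ i $ p i) = 0"
        by simp
    qed
  qed simp
  also have "\<dots> = principal_minor M S"
    unfolding principal_minor_def
  proof (rule sum.cong)
    fix p assume "p \<in> {p. p permutes S}"
    then have p: "p permutes S" by simp
    have "(\<Prod>i\<in>UNIV. N $ i $ p i) = (\<Prod>i\<in>S. N $ i $ p i)"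
      using p assms(2) by (intro prod.mono_neutral_right) (auto simp: permutes_not_in)
    also have "\<dots> = (\<Prod>i\<in>S. M $ i $ p i)"
      using p assms(1) by (intro prod.cong) (auto simp: permutes_in_image)
    finally show "of_int (sign p) * (\<Prod>i\<in>UNIV. N $ i $ p i)
        = of_int (sign p) * (\<Prod>i\<in>S. M $ i $ p i)"
      by simp
  qed simp
  finally show ?thesis .
qed

lemma principal_minor_transpose: "principal_minor (transpose M) S = principal_minor M S"
proof -
  let ?N = "\<chi> i j. if i \<in> S \<and> j \<in> S then M $ i $ j else if i = j then 1 else 0"
  have "principal_minor (transpose M) S = det (transpose ?N)"
    by (rule det_eq_principal_minor[symmetric]) (auto simp: transpose_def)
  also have "\<dots> = principal_minor M S"
    unfolding det_transpose by (rule det_eq_principal_minor) auto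
  finally show ?thesis .
qed

lemma principal_minor_reindex:
  fixes M :: "'a::comm_ring_1^'n^'n"
  assumes "bij f"
  shows "principal_minor (\<chi> i j. M $ f i $ f j) S = principal_minor M (f ` S)"
proof -
  have f: "inj f" "range f = UNIV"
    using assms by (auto simp: bij_def)
  let ?N = "\<chi> i j. if i \<in> f ` S \<and> j \<in> f ` S then M $ i $ j else if i = j then 1 else 0"
  have "principal_minor (\<chi> i j. M $ f i $ f j) S = det (\<chi> i j. ?N $ f i $ f j)"
    by (rule det_eq_principal_minor[symmetric])
      (auto simp: inj_image_mem_iff[OF f(1)] inj_eq[OF f(1)])
  \<comment> \<open>As \<open>range f\<close> is the whole index type,
    \<open>principal_minor_range\<close> says here that reindexing rows and columns simultaneously
    preserves the determinant.\<close>
  also have "\<dots> = det ?N"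
    using principal_minor_range[OF f(1), of ?N] by (simp add: f(2) principal_minor_UNIV)
  also have "\<dots> = principal_minor M (f ` S)"
    by (rule det_eq_principal_minor) auto
  finally show ?thesis .
qed

text \<open>Each summand of the minor takes exactly one entry from every row and every column in
  \<open>S\<close>, so it picks up every \<open>a i\<close> and every \<open>b j\<close>
  once.\<close>

lemma principal_minor_scale:
  assumes "\<And>i j. N $ i $ j = a i * M $ i $ j * b j"
  shows "principal_minor N S = prod a S * prod b S * principal_minor M S"
proof -
  have "(\<Prod>i\<in>S. N $ i $ p i) = prod a S * prod b S * (\<Prod>i\<in>S. M $ i $ p i)"
    if "p permutes S" for p
    using prod.permute[OF that, of b] by (simp add: assms prod.distrib o_def mult_ac)
  then show ?thesis
    by (simp add: principal_minor_def sum_distrib_left mult_ac)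
qed

text \<open>Jacobi's identity. Replace the columns of \<open>C = B\<inverse>\<close> outside \<open>S\<close> by unit vectors; then
  multiplication by \<open>B\<close> turns the columns in \<open>S\<close> into unit vectors and the others into
  those of \<open>B\<close>.\<close>

lemma principal_minor_inverse:
  fixes B C :: "'a::comm_ring_1^'n^'n"
  assumes "B ** C = mat 1"
  shows "det B * principal_minor C S = principal_minor B (- S)"
proof -
  let ?C = "\<chi> i j. if j \<in> S then C $ i $ j else if i = j then 1 else 0"
  have entry: "(B ** ?C) $ i $ j = (if j \<in> S then if i = j then 1 else 0 else B $ i $ j)" for i j
  proof (cases "j \<in> S")
    case True
    then have "(B ** ?C) $ i $ j = (B ** C) $ i $ j"
      by (simp add: matrix_matrix_mult_def)
    then show ?thesis using True by (simp add: assms mat_def)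
  next
    case False
    then have "(B ** ?C) $ i $ j = (\<Sum>k\<in>UNIV. if k = j then B $ i $ k else 0)"
      by (simp add: matrix_matrix_mult_def if_distrib[of "\<lambda>x. _ * x"] cong: if_cong)
    then show ?thesis using False by simp
  qed
  have "det B * principal_minor C S = det B * det ?C"
    by (subst det_eq_principal_minor[of S ?C C]) auto
  also have "\<dots> = det (B ** ?C)"
    by (rule det_mul[symmetric])
  also have "\<dots> = principal_minor B (- S)"
    by (rule det_eq_principal_minor) (simp_all add: entry)
  finally show ?thesis .
qed

section \<open>P-matrices and EP-matrices\<close>

text \<open>By Jacobi's identity each minor of \<open>C\<close> is a quotient of two positive
  numbers, a minor of \<open>B\<close> and \<open>det B\<close>.\<close>

lemma P_matrix_inverse:
  assumes B: "P_matrix B" and "B ** C = mat 1"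
  shows "P_matrix C"
  unfolding P_matrix_def
proof (intro allI impI)
  fix S :: "'a set"
  have "det B > 0"
    using B by (simp add: P_matrix_def flip: principal_minor_UNIV)
  \<comment> \<open>For \<open>S = UNIV\<close> the complement is empty, which
    \<open>P_matrix\<close> does not cover; the empty minor is 1.\<close>
  moreover have "principal_minor B (- S) > 0"
    using B by (cases "- S = {}") (auto simp: P_matrix_def principal_minor_def)
  ultimately show "principal_minor C S > 0"
    using principal_minor_inverse[OF assms(2), of S] by (metis zero_less_mult_pos)
qed

lemma P_matrix_transpose: "P_matrix M \<Longrightarrow> P_matrix (transpose M)"
  by (simp add: P_matrix_def principal_minor_transpose)

text \<open>Only the products \<open>a i * b i\<close> enter the sign of a minor, so the factors
  themselves may be negative. This covers signature matrices as well as scaling of the columns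
  alone.\<close>

lemma P_matrix_scale:
  assumes "P_matrix M" "\<And>i j. N $ i $ j = a i * M $ i $ j * b j" "\<And>i. a i * b i > 0"
  shows "P_matrix N"
proof -
  have "prod a S * prod b S > 0" for S
    using assms(3) by (simp add: prod.distrib[symmetric] prod_pos)
  then show ?thesis
    using assms(1) by (simp add: P_matrix_def principal_minor_scale[OF assms(2)])
qed

lemma P_matrix_reindex: "bij f \<Longrightarrow> P_matrix M \<Longrightarrow> P_matrix (\<chi> i j. M $ f i $ f j)"
  by (simp add: P_matrix_def principal_minor_reindex)

text \<open>Common core of the permutation, positive diagonal and signature cases: it remains to
  show for each that the similarity preserves P-matrices.\<close>

lemma EP_matrix_similar:
  fixes A P R :: "real^'n^'n"
  assumes "EP_matrix A" "R ** P = mat 1" "\<And>M. P_matrix M \<Longrightarrow> P_matrix (P ** M ** R)"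
  shows "EP_matrix (P ** A ** R)"
proof -
  have "matrix_exp (t *\<^sub>R (P ** A ** R)) = P ** matrix_exp (t *\<^sub>R A) ** R" for t
    using matrix_exp_similar[OF assms(2), of "t *\<^sub>R A"]
    by (simp add: matrix_mult_scaleR_left matrix_mult_scaleR_right)
  then show ?thesis
    using assms by (simp add: EP_matrix_def)
qed

section \<open>The six closure properties\<close>

lemma EP_matrix_scaleR:
  assumes "EP_matrix A"
  shows "EP_matrix (c *\<^sub>R A)"
  unfolding EP_matrix_def
proof (intro allI impI)
  fix t :: real assume t: "t \<ge> 0"
  show "P_matrix (matrix_exp (t *\<^sub>R c *\<^sub>R A))"
  proof (cases "c \<ge> 0")
    case True
    then show ?thesis using assms t by (simp add: EP_matrix_def)
  next
    case False
    \<comment> \<open>The nonnegative time \<open>t * (- c)\<close> gives a P-matrix whose inverse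
      is the exponential wanted at \<open>t * c\<close>.\<close>
    then have "t * (- c) \<ge> 0"
      using t by (intro mult_nonneg_nonneg) auto
    then have "P_matrix (matrix_exp ((t * (- c)) *\<^sub>R A))"
      using assms unfolding EP_matrix_def by blast
    from P_matrix_inverse[OF this matrix_exp_minus] show ?thesis by simp
  qed
qed

lemma EP_matrix_transpose: "EP_matrix A \<Longrightarrow> EP_matrix (transpose A)"
proof -
  have "t *\<^sub>R transpose A = transpose (t *\<^sub>R A)" for t
    by (simp add: transpose_def vec_eq_iff)
  then show "EP_matrix A \<Longrightarrow> EP_matrix (transpose A)"
    by (simp add: EP_matrix_def matrix_exp_transpose P_matrix_transpose)
qed

lemma EP_matrix_permutation:
  fixes A Q :: "real^'n^'n"
  assumes A: "EP_matrix A" and Q: "permutation_matrix Q"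
  shows "EP_matrix (Q ** A ** transpose Q)"
proof -
  \<comment> \<open>\<open>f i\<close> is the column of the 1 in row \<open>i\<close>. The unique 1
    in each column makes \<open>f\<close> bijective, and conjugation by \<open>Q\<close> becomes
    reindexing along \<open>f\<close>.\<close>
  obtain f where f: "\<And>i j. Q $ i $ j = 1 \<longleftrightarrow> j = f i"
    using Q unfolding permutation_matrix_def by metis
  have Q_eq: "Q $ i $ j = (if j = f i then 1 else 0)" for i j
    using Q f unfolding permutation_matrix_def by metis
  have bij: "bij f"
    using Q unfolding permutation_matrix_def f bij_iff by metis
  have mult_left: "(Q ** M) $ i $ j = M $ f i $ j" for M :: "real^'n^'n" and i j
    by (simp add: matrix_matrix_mult_def Q_eq if_distrib[of "\<lambda>x. x * _"] cong: if_cong)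
  have mult_right: "(M ** transpose Q) $ i $ j = M $ i $ f j" for M :: "real^'n^'n" and i j
    by (simp add: matrix_matrix_mult_def transpose_def Q_eq if_distrib cong: if_cong)
  have conj: "Q ** M ** transpose Q = (\<chi> i j. M $ f i $ f j)" for M
    by (simp add: vec_eq_iff mult_left mult_right)
  have "Q ** transpose Q = mat 1"
    using bij_is_inj[OF bij] by (auto simp: vec_eq_iff mult_right Q_eq mat_def dest: injD)
  then have "transpose Q ** Q = mat 1"
    using matrix_left_right_inverse by blast
  then show ?thesis
    by (rule EP_matrix_similar[OF A]) (simp add: conj P_matrix_reindex bij)
qed

text \<open>\<open>E\<close> is the inverse of \<open>D\<close>, stated on the diagonal entries so
  that the same equation supplies the sign condition of \<open>P_matrix_scale\<close>. A signature
  matrix serves as both \<open>D\<close> and \<open>E\<close>.\<close>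

lemma EP_matrix_diagonal_similar:
  assumes A: "EP_matrix A" and D: "diagonal_matrix D" and E: "diagonal_matrix E"
    and DE: "\<And>i. D $ i $ i * E $ i $ i = 1"
  shows "EP_matrix (D ** A ** E)"
proof (rule EP_matrix_similar[OF A])
  show "E ** D = mat 1"
    using E DE by (auto simp: vec_eq_iff mat_def diagonal_matrix_mult_right[OF D]
        diagonal_matrix_def mult.commute)
  show "P_matrix (D ** M ** E)" if "P_matrix M" for M
    by (rule P_matrix_scale[OF that, where a = "\<lambda>i. D $ i $ i" and b = "\<lambda>i. E $ i $ i"])
      (simp_all add: diagonal_matrix_mult_left[OF D] diagonal_matrix_mult_right[OF E] DE)
qed

lemma matrix_inv_eqI:
  fixes A B :: "real^'n^'n"
  assumes "A ** B = mat 1"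
  shows "matrix_inv A = B"
proof -
  have BA: "B ** A = mat 1"
    using assms matrix_left_right_inverse by blast
  \<comment> \<open>\<open>matrix_inv\<close> chooses some two-sided inverse; \<open>B\<close>
    witnesses that one exists, and uniqueness then identifies the two.\<close>
  have "A ** matrix_inv A = mat 1 \<and> matrix_inv A ** A = mat 1"
    unfolding matrix_inv_def by (rule someI[of _ B]) (use assms BA in blast)
  then show ?thesis
    using BA by (metis matrix_mul_assoc matrix_mul_lid matrix_mul_rid)
qed

lemma EP_matrix_positive_diagonal:
  assumes A: "EP_matrix A" and D: "positive_diagonal_matrix D"
  shows "EP_matrix (D ** A ** matrix_inv D)"
proof -
  let ?E = "\<chi> i j. if i = j then inverse (D $ i $ i) else 0"
  have diag: "diagonal_matrix D" and nz: "D $ i $ i \<noteq> 0" for i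
    using D by (auto simp: positive_diagonal_matrix_def less_imp_neq[symmetric])
  have "D ** ?E = mat 1"
    by (simp add: vec_eq_iff mat_def diagonal_matrix_mult_left[OF diag] nz)
  then have "matrix_inv D = ?E"
    by (rule matrix_inv_eqI)
  then show ?thesis
    by (auto intro!: EP_matrix_diagonal_similar[OF A diag] simp: nz diagonal_matrix_def)
qed

lemma EP_matrix_signature:
  assumes "EP_matrix A" "signature_matrix S"
  shows "EP_matrix (S ** A ** S)"
proof (rule EP_matrix_diagonal_similar)
  show "S $ i $ i * S $ i $ i = 1" for i
    using assms(2) by (metis signature_matrix_def mult_1 mult_minus1 minus_minus)
qed (use assms in \<open>auto simp: signature_matrix_def\<close>)

text \<open>By commutation the exponential splits off the factor \<open>exp (tD)\<close>, a diagonal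
  matrix with positive entries whatever the signs in \<open>D\<close>; it merely scales columns by
  positive numbers.\<close>

lemma EP_matrix_add_diagonal:
  assumes A: "EP_matrix A" and D: "diagonal_matrix D" and comm: "D ** A = A ** D"
  shows "EP_matrix (A + D)"
  unfolding EP_matrix_def
proof (intro allI impI)
  fix t :: real assume t: "t \<ge> 0"
  have tD: "diagonal_matrix (t *\<^sub>R D)"
    using D by (simp add: diagonal_matrix_def)
  let ?E = "matrix_exp (t *\<^sub>R D)"
  have E: "diagonal_matrix ?E"
    by (simp add: matrix_exp_diagonal[OF tD] diagonal_matrix_def)
  have "t *\<^sub>R A ** t *\<^sub>R D = t *\<^sub>R D ** t *\<^sub>R A"
    by (simp add: matrix_mult_scaleR_left matrix_mult_scaleR_right comm)
  then have "matrix_exp (t *\<^sub>R (A + D)) = matrix_exp (t *\<^sub>R A) ** ?E"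
    by (simp add: scaleR_right_distrib matrix_exp_add)
  moreover have "P_matrix (matrix_exp (t *\<^sub>R A) ** ?E)"
  proof (rule P_matrix_scale)
    show "P_matrix (matrix_exp (t *\<^sub>R A))"
      using A t by (simp add: EP_matrix_def)
    show "(matrix_exp (t *\<^sub>R A) ** ?E) $ i $ j
        = 1 * matrix_exp (t *\<^sub>R A) $ i $ j * exp ((t *\<^sub>R D) $ j $ j)" for i j
      unfolding diagonal_matrix_mult_right[OF E] by (simp add: matrix_exp_diagonal[OF tD])
  qed simp
  ultimately show "P_matrix (matrix_exp (t *\<^sub>R (A + D)))"
    by simp
qed

theorem theorem5:
  fixes A :: "real^'n^'n"
  assumes "EP_matrix A"
  shows "(\<forall>c::real. EP_matrix (c *\<^sub>R A)) \<and>
    EP_matrix (transpose A) \<and>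
    (\<forall>Q::real^'n^'n. permutation_matrix Q \<longrightarrow> EP_matrix (Q ** A ** transpose Q)) \<and>
    (\<forall>D::real^'n^'n. positive_diagonal_matrix D \<longrightarrow> EP_matrix (D ** A ** matrix_inv D)) \<and>
    (\<forall>S::real^'n^'n. signature_matrix S \<longrightarrow> EP_matrix (S ** A ** S)) \<and>
    (\<forall>D::real^'n^'n. diagonal_matrix D \<and> D ** A = A ** D \<longrightarrow> EP_matrix (A + D))"
  using EP_matrix_scaleR[OF assms] EP_matrix_transpose[OF assms] EP_matrix_permutation[OF assms]
    EP_matrix_positive_diagonal[OF assms] EP_matrix_signature[OF assms]
    EP_matrix_add_diagonal[OF assms]
  by blast

end
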